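(* Let $M\ge 1$ be an integer, let $\lambda_p,\epsilon_{s_1},\epsilon_{s_2}\in[0,1]$, and let $q_1,\dots,q_M\in[0,1]$. Consider a secondary user (SU) that has at most $M$ trials to deliver a packet in the presence of a primary user (PU), according to the opportunistic ARQ transmission model described in the context. For $1\le m\le M$ let $P_{SU}(m)$ be the probability that the $m$-th trial is reached, and let $P_{SU}(M+1)$ be the probability that all $M$ trials fail. Then the SU's cumulative outage probability $\epsilon_s$ satisfies $$\epsilon_s=P_{SU}(M+1)=\prod_{i=1}^{M}\theta_i=\prod_{i=1}^{M}\left(\beta q_i+T\right),$$ where $\theta_i=\beta q_i+T$, $\beta=\lambda_p(\epsilon_{s_2}-1)$ and $T=\lambda_p(1-\epsilon_{s_1})+\epsilon_{s_1}$.
   Context: Opportunistic ARQ transmission model. A packet of the secondary user (SU) is given at most $M$ trials (time slots), numbered $1,\dots,M$. In each trial the primary user (PU) is transmitting with probability $\lambda_p$ and silent with probability $1-\lambda_p$. Given that the packet has not been successfully decoded before the $m$-th trial, the SU senses the PU perfectly and behaves as follows in the $m$-th trial: - if the PU is silent, the SU transmits with probability $1$, and the transmission is in error with probability $\epsilon_{s_1}$; - if the PU is transmitting, the SU transmits with access probability $q_m$ and remains silent with probability $1-q_m$; if it transmits, the transmission is in error with probability $\epsilon_{s_2}$. A trial succeeds if the SU transmits and the transmission is not in error; otherwise (the SU stays silent, or transmits with an error) the trial fails. All random events (PU activity, SU access decisions, transmission errors) in different trials are independent. The $m$-th trial is reached if and only if trials $1,\dots,m-1$ all fail (so trial $1$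 is always reached). The cumulative outage probability $\epsilon_s$ is the probability that the packet is not successfully delivered after exhausting all $M$ trials. *)

theory Defs
  imports "HOL-Probability.Probability"
begin

text \<open>
  Trials are numbered from 1. For a sample point \<open>w\<close>, \<open>pu m w\<close> means that the primary user is
  transmitting in trial \<open>m\<close>; \<open>tx m w\<close> and \<open>err m w\<close> mean that the secondary user transmits in
  trial \<open>m\<close>, resp. that its transmission is in error, if trial \<open>m\<close> takes place.
  The value of \<open>err m w\<close> is irrelevant when \<open>tx m w\<close> is false.
\<close>

definition trial_succeeds ::
    "(nat \<Rightarrow> 'a \<Rightarrow> bool) \<Rightarrow> (nat \<Rightarrow> 'a \<Rightarrow> bool) \<Rightarrow> nat \<Rightarrow> 'a \<Rightarrow> bool" where
  "trial_succeeds tx err m w \<longleftrightarrow> tx m w \<and> \<not> err m w"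

definition trial_reached ::
    "(nat \<Rightarrow> 'a \<Rightarrow> bool) \<Rightarrow> (nat \<Rightarrow> 'a \<Rightarrow> bool) \<Rightarrow> nat \<Rightarrow> 'a \<Rightarrow> bool" where
  "trial_reached tx err m w \<longleftrightarrow> (\<forall>i\<in>{1..<m}. \<not> trial_succeeds tx err i w)"

definition delivered ::
    "nat \<Rightarrow> (nat \<Rightarrow> 'a \<Rightarrow> bool) \<Rightarrow> (nat \<Rightarrow> 'a \<Rightarrow> bool) \<Rightarrow> 'a \<Rightarrow> bool" where
  "delivered M tx err w \<longleftrightarrow>
     (\<exists>m\<in>{1..M}. trial_reached tx err m w \<and> trial_succeeds tx err m w)"

text \<open>With \<open>M\<close> trials, the argument \<open>M + 1\<close> gives the probability that all \<open>M\<close> trials fail.\<close>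

definition P_SU ::
    "'a measure \<Rightarrow> (nat \<Rightarrow> 'a \<Rightarrow> bool) \<Rightarrow> (nat \<Rightarrow> 'a \<Rightarrow> bool) \<Rightarrow> nat \<Rightarrow> real" where
  "P_SU \<Omega> tx err m = \<P>(w in \<Omega>. trial_reached tx err m w)"

definition outage_prob ::
    "'a measure \<Rightarrow> nat \<Rightarrow> (nat \<Rightarrow> 'a \<Rightarrow> bool) \<Rightarrow> (nat \<Rightarrow> 'a \<Rightarrow> bool) \<Rightarrow> real" where
  "outage_prob \<Omega> M tx err = \<P>(w in \<Omega>. \<not> delivered M tx err w)"

text \<open>
  \<open>cond_prob\<close> is 0 when the conditioning event is null; a prescribed conditional probability
  must impose nothing in that case.
\<close>

definition has_cond_prob ::
    "'a measure \<Rightarrow> ('a \<Rightarrow> bool) \<Rightarrow> ('a \<Rightarrow> bool) \<Rightarrow> real \<Rightarrow> bool" where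
  "has_cond_prob \<Omega> P Q p \<longleftrightarrow>
     (\<P>(w in \<Omega>. Q w) \<noteq> 0 \<longrightarrow> \<P>(w in \<Omega>. P w \<bar> Q w) = p)"

text \<open>
  Independence is required between trials only: within a trial the joint law of \<open>pu\<close>, \<open>tx\<close> and
  \<open>err\<close> is given by successive conditioning. \<open>indep_vars\<close> includes measurability.
\<close>

locale opportunistic_arq = prob_space \<Omega>
  for \<Omega> :: "'a measure" +
  fixes M :: nat
    and lambda_p eps_s1 eps_s2 :: real
    and q :: "nat \<Rightarrow> real"
    and pu tx err :: "nat \<Rightarrow> 'a \<Rightarrow> bool"
  assumes trials_indep:
      "indep_vars (\<lambda>_. count_space UNIV) (\<lambda>m w. (pu m w, tx m w, err m w)) {1..M}"
    and pu_active:
      "m \<in> {1..M} \<Longrightarrow> \<P>(w in \<Omega>. pu m w) = lambda_p"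
    and tx_if_pu_silent:
      "m \<in> {1..M} \<Longrightarrow>
         has_cond_prob \<Omega> (\<lambda>w. tx m w) (\<lambda>w. trial_reached tx err m w \<and> \<not> pu m w) 1"
    and err_if_pu_silent:
      "m \<in> {1..M} \<Longrightarrow>
         has_cond_prob \<Omega> (\<lambda>w. err m w)
           (\<lambda>w. trial_reached tx err m w \<and> \<not> pu m w \<and> tx m w) eps_s1"
    and tx_if_pu_active:
      "m \<in> {1..M} \<Longrightarrow>
         has_cond_prob \<Omega> (\<lambda>w. tx m w) (\<lambda>w. trial_reached tx err m w \<and> pu m w) (q m)"
    and err_if_pu_active:
      "m \<in> {1..M} \<Longrightarrow>
         has_cond_prob \<Omega> (\<lambda>w. err m w)
           (\<lambda>w. trial_reached tx err m w \<and> pu m w \<and> tx m w) eps_s2"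

end

theory Submission
  imports Defs
begin

text \<open>
  Reaching trial \<open>m\<close> depends on the earlier trials only, so it is independent of the primary
  user's activity in trial \<open>m\<close>. Successive conditioning inside trial \<open>m\<close> then gives
  \<open>P_SU (m + 1) = (\<beta> * q m + T) * P_SU m\<close>, also when \<open>P_SU m = 0\<close>, and the product formula follows by induction.
\<close>

text \<open>If some trial among the first \<open>M\<close> succeeds, the least such trial is
  preceded by failures only, so it is reached and delivers the packet. The equivalence is pointwise,
  so outage and reaching trial \<open>M + 1\<close> are the same event.\<close>

lemma not_delivered_iff_reached: "\<not> delivered M tx err w \<longleftrightarrow> trial_reached tx err (M + 1) w"
proof -
  have "\<exists>m\<in>{1..M}. (\<forall>i\<in>{1..<m}. \<not> S i) \<and> S m" if "\<exists>k\<in>{1..M}. S k" for S :: "nat \<Rightarrow> bool"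
    using that exists_least_iff[of "\<lambda>k. k \<in> {1..M} \<and> S k"] by fastforce
  from this[of "\<lambda>i. trial_succeeds tx err i w"] show ?thesis
    unfolding delivered_def trial_reached_def by fastforce
qed

lemma trial_reached_Suc:
  "1 \<le> m \<Longrightarrow> trial_reached tx err (Suc m) w \<longleftrightarrow>
     trial_reached tx err m w \<and> \<not> trial_succeeds tx err m w"
  unfolding trial_reached_def by (auto simp: less_Suc_eq)

text \<open>The multiplication rule, free of a positivity condition: for a null \<open>Q\<close>
  both sides vanish by monotonicity, so it does not matter that \<open>has_cond_prob\<close> then
  says nothing.\<close>

lemma (in prob_space) prob_conj_if_has_cond_prob:
  assumes "has_cond_prob M P Q p"
    and [measurable]: "Measurable.pred M P" "Measurable.pred M Q"
  shows "\<P>(w in M. Q w \<and> P w) = p * \<P>(w in M. Q w)"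
proof (cases "\<P>(w in M. Q w) = 0")
  case True
  moreover have "\<P>(w in M. Q w \<and> P w) \<le> \<P>(w in M. Q w)"
    by (intro finite_measure_mono) auto
  ultimately show ?thesis by (simp add: measure_le_0_iff)
next
  case False
  then show ?thesis
    using assms(1) by (auto simp: has_cond_prob_def cond_prob_def field_simps conj_commute)
qed

lemma (in prob_space) prob_conj_not:
  assumes [measurable]: "Measurable.pred M P" "Measurable.pred M Q"
  shows "\<P>(w in M. Q w \<and> \<not> P w) = \<P>(w in M. Q w) - \<P>(w in M. Q w \<and> P w)"
proof -
  have "{w \<in> space M. Q w \<and> \<not> P w} = {w \<in> space M. Q w} - {w \<in> space M. Q w \<and> P w}"
    by auto
  then show ?thesis
    by (simp only:) (intro finite_measure_Diff; auto)
qed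

context opportunistic_arq
begin

lemma measurable_trial:
  assumes "m \<in> {1..M}"
  shows "Measurable.pred \<Omega> (pu m)" "Measurable.pred \<Omega> (tx m)" "Measurable.pred \<Omega> (err m)"
proof -
  have "(\<lambda>w. (pu m w, tx m w, err m w)) \<in> \<Omega> \<rightarrow>\<^sub>M count_space UNIV"
    using trials_indep assms by (auto simp: indep_vars_def)
  \<comment> \<open>The triple takes values in a discrete space, so composing it with any projection
    stays measurable.\<close>
  note * = measurable_compose[OF this, of _ "count_space UNIV"]
  show "Measurable.pred \<Omega> (pu m)" "Measurable.pred \<Omega> (tx m)" "Measurable.pred \<Omega> (err m)"
    using *[of fst] *[of "\<lambda>x. fst (snd x)"] *[of "\<lambda>x. snd (snd x)"] by simp_all
qed

lemma measurable_trial_reached: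
  assumes "m \<le> M + 1"
  shows "Measurable.pred \<Omega> (trial_reached tx err m)"
proof -
  have [measurable]: "Measurable.pred \<Omega> (tx i)" "Measurable.pred \<Omega> (err i)" if "i \<in> {1..<m}" for i
    using measurable_trial[of i] assms that by auto
  show ?thesis
    unfolding trial_reached_def[abs_def] trial_succeeds_def by measurable
qed

lemma prob_reached_and_pu:
  assumes m: "m \<in> {1..M}"
  shows "\<P>(w in \<Omega>. trial_reached tx err m w \<and> pu m w) = P_SU \<Omega> tx err m * lambda_p"
proof -
  define X where "X = (\<lambda>m w. (pu m w, tx m w, err m w))"
  \<comment> \<open>The outcomes of a failed trial: reaching trial \<open>m\<close> means that
    \<open>X i\<close> lies in \<open>F\<close> for all earlier \<open>i\<close>.\<close>
  define F where "F = {(p::bool, t, e). \<not> (t \<and> \<not> e)}"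
  \<comment> \<open>\<open>B\<close> stays general because two instances are compared below.\<close>
  have factor: "\<P>(w in \<Omega>. trial_reached tx err m w \<and> X m w \<in> B) =
      (\<Prod>i\<in>{1..<m}. prob (X i -` F \<inter> space \<Omega>)) * prob (X m -` B \<inter> space \<Omega>)" for B
  proof -
    \<comment> \<open>Constraining trial \<open>m\<close> by \<open>B\<close> and the earlier ones
      by \<open>F\<close> turns the event into one intersection over \<open>{1..m}\<close>, the form
      to which independence applies.\<close>
    define A where "A = (\<lambda>i. if i = m then B else F)"
    have "{w \<in> space \<Omega>. trial_reached tx err m w \<and> X m w \<in> B} =
        (\<Inter>i\<in>{1..m}. X i -` A i \<inter> space \<Omega>)"
    proof (intro set_eqI iffI)
      fix w assume "w \<in> {w \<in> space \<Omega>. trial_reached tx err m w \<and> X m w \<in> B}"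
      then show "w \<in> (\<Inter>i\<in>{1..m}. X i -` A i \<inter> space \<Omega>)"
        by (auto simp: A_def F_def X_def trial_reached_def trial_succeeds_def)
    next
      fix w assume *: "w \<in> (\<Inter>i\<in>{1..m}. X i -` A i \<inter> space \<Omega>)"
      then have "w \<in> X m -` A m \<inter> space \<Omega>"
        using m by (intro INT_D[OF *]) auto
      moreover have "\<not> trial_succeeds tx err i w" if "i \<in> {1..<m}" for i
        using INT_D[OF *, of i] that
        by (auto simp: A_def F_def X_def trial_succeeds_def)
      ultimately show "w \<in> {w \<in> space \<Omega>. trial_reached tx err m w \<and> X m w \<in> B}"
        by (auto simp: A_def trial_reached_def)
    qed
    also have "prob \<dots> = (\<Prod>i\<in>{1..m}. prob (X i -` A i \<inter> space \<Omega>))"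
      using m by (intro indep_varsD[OF trials_indep[folded X_def]]) auto
    also have "{1..m} = insert m {1..<m}"
      using m by auto
    also have "(\<Prod>i\<in>insert m {1..<m}. prob (X i -` A i \<inter> space \<Omega>)) =
        (\<Prod>i\<in>{1..<m}. prob (X i -` F \<inter> space \<Omega>)) * prob (X m -` B \<inter> space \<Omega>)"
      by (simp add: A_def)
    finally show ?thesis .
  qed
  \<comment> \<open>\<open>B = UNIV\<close> identifies the product over the earlier trials with
    \<open>P_SU\<close> at \<open>m\<close>; \<open>B = {x. fst x}\<close> multiplies the same
    product by \<open>lambda_p\<close>. No division occurs, so a null \<open>P_SU\<close> is
    harmless.\<close>
  have "X m -` {x. fst x} \<inter> space \<Omega> = {w \<in> space \<Omega>. pu m w}"
    by (auto simp: X_def)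
  then show ?thesis
    using factor[of UNIV] factor[of "{x. fst x}"] pu_active[OF m]
    by (simp add: P_SU_def prob_space) (simp add: X_def)
qed

text \<open>The loss from \<open>m\<close> to \<open>Suc m\<close> is the mass of reached successes,
  split by the activity of the primary user. The factor is 1 - (1 - \<open>lambda_p\<close>)(1 -
  \<open>eps_s1\<close>) - \<open>lambda_p\<close> \<open>q m\<close> (1 - \<open>eps_s2\<close>),
  rearranged.\<close>

lemma P_SU_Suc:
  assumes m: "m \<in> {1..M}"
  shows "P_SU \<Omega> tx err (Suc m) =
    P_SU \<Omega> tx err m * (lambda_p * (eps_s2 - 1) * q m + (lambda_p * (1 - eps_s1) + eps_s1))"
proof -
  let ?R = "trial_reached tx err m"
  note [measurable] = measurable_trial[OF m]
  have [measurable]: "Measurable.pred \<Omega> ?R"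
    using m by (intro measurable_trial_reached) auto
  have pu: "\<P>(w in \<Omega>. ?R w \<and> pu m w) = P_SU \<Omega> tx err m * lambda_p"
    by (rule prob_reached_and_pu[OF m])
  have silent: "\<P>(w in \<Omega>. ?R w \<and> \<not> pu m w) = P_SU \<Omega> tx err m * (1 - lambda_p)"
    by (subst prob_conj_not) (simp_all add: pu P_SU_def algebra_simps)
  \<comment> \<open>Access has conditional probability 1 here, so no mass is lost.\<close>
  have silent_tx: "\<P>(w in \<Omega>. ?R w \<and> \<not> pu m w \<and> tx m w) = P_SU \<Omega> tx err m * (1 - lambda_p)"
    using prob_conj_if_has_cond_prob[OF tx_if_pu_silent[OF m]] silent by simp
  have silent_err: "\<P>(w in \<Omega>. ?R w \<and> \<not> pu m w \<and> tx m w \<and> err m w) =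
      eps_s1 * (P_SU \<Omega> tx err m * (1 - lambda_p))"
    using prob_conj_if_has_cond_prob[OF err_if_pu_silent[OF m]] silent_tx by simp
  have active_tx: "\<P>(w in \<Omega>. ?R w \<and> pu m w \<and> tx m w) = q m * (P_SU \<Omega> tx err m * lambda_p)"
    using prob_conj_if_has_cond_prob[OF tx_if_pu_active[OF m]] pu by simp
  have active_err: "\<P>(w in \<Omega>. ?R w \<and> pu m w \<and> tx m w \<and> err m w) =
      eps_s2 * (q m * (P_SU \<Omega> tx err m * lambda_p))"
    using prob_conj_if_has_cond_prob[OF err_if_pu_active[OF m]] active_tx by simp
  let ?S = "\<lambda>w. trial_succeeds tx err m w"
  have [measurable]: "Measurable.pred \<Omega> ?S"
    unfolding trial_succeeds_def by measurable
  \<comment> \<open>Success is regrouped as transmission minus erroneous transmission, both of whose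
    masses are known.\<close>
  have "\<P>(w in \<Omega>. (?R w \<and> ?S w) \<and> pu m w) =
      \<P>(w in \<Omega>. (?R w \<and> pu m w \<and> tx m w) \<and> \<not> err m w)"
    by (intro arg_cong[where f = prob]) (auto simp: trial_succeeds_def)
  also have "\<dots> = P_SU \<Omega> tx err m * lambda_p * q m * (1 - eps_s2)"
    by (subst prob_conj_not) (simp_all add: active_tx active_err algebra_simps)
  finally have success_active: "\<P>(w in \<Omega>. (?R w \<and> ?S w) \<and> pu m w) = \<dots>" .
  have "\<P>(w in \<Omega>. (?R w \<and> ?S w) \<and> \<not> pu m w) =
      \<P>(w in \<Omega>. (?R w \<and> \<not> pu m w \<and> tx m w) \<and> \<not> err m w)"
    by (intro arg_cong[where f = prob]) (auto simp: trial_succeeds_def)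
  also have "\<dots> = P_SU \<Omega> tx err m * (1 - lambda_p) * (1 - eps_s1)"
    by (subst prob_conj_not) (simp_all add: silent_tx silent_err algebra_simps)
  finally have success_silent: "\<P>(w in \<Omega>. (?R w \<and> ?S w) \<and> \<not> pu m w) = \<dots>" .
  \<comment> \<open>The two branches add up to the total mass of reached successes.\<close>
  have "\<P>(w in \<Omega>. (?R w \<and> ?S w) \<and> \<not> pu m w) =
      \<P>(w in \<Omega>. ?R w \<and> ?S w) - \<P>(w in \<Omega>. (?R w \<and> ?S w) \<and> pu m w)"
    by (rule prob_conj_not) measurable
  moreover have "P_SU \<Omega> tx err (Suc m) = P_SU \<Omega> tx err m - \<P>(w in \<Omega>. ?R w \<and> ?S w)"
    using m by (simp add: P_SU_def trial_reached_Suc prob_conj_not)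
  ultimately show ?thesis
    unfolding success_active success_silent by (simp add: algebra_simps)
qed

lemma P_SU_eq_prod:
  "n \<le> M \<Longrightarrow> P_SU \<Omega> tx err (n + 1) =
    (\<Prod>i=1..n. lambda_p * (eps_s2 - 1) * q i + (lambda_p * (1 - eps_s1) + eps_s1))"
proof (induction n)
  \<comment> \<open>Trial 1 is always reached, which matches the empty product.\<close>
  case 0
  then show ?case by (simp add: P_SU_def trial_reached_def prob_space)
next
  case (Suc n)
  then show ?case by (simp add: P_SU_Suc)
qed

end

theorem lemma1:
  fixes \<Omega> :: "'a measure"
    and M :: nat
    and lambda_p eps_s1 eps_s2 :: real
    and q :: "nat \<Rightarrow> real"
    and pu tx err :: "nat \<Rightarrow> 'a \<Rightarrow> bool"
    and \<beta> T :: real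
    and \<theta> :: "nat \<Rightarrow> real"
  assumes "M \<ge> 1"
    and "lambda_p \<in> {0..1}" and "eps_s1 \<in> {0..1}" and "eps_s2 \<in> {0..1}"
    and "\<And>m. m \<in> {1..M} \<Longrightarrow> q m \<in> {0..1}"
    and "opportunistic_arq \<Omega> M lambda_p eps_s1 eps_s2 q pu tx err"
    and "\<beta> = lambda_p * (eps_s2 - 1)"
    and "T = lambda_p * (1 - eps_s1) + eps_s1"
    and "\<And>i. i \<in> {1..M} \<Longrightarrow> \<theta> i = \<beta> * q i + T"
  shows "outage_prob \<Omega> M tx err = P_SU \<Omega> tx err (M + 1)
    \<and> P_SU \<Omega> tx err (M + 1) = (\<Prod>i=1..M. \<theta> i)
    \<and> (\<Prod>i=1..M. \<theta> i) = (\<Prod>i=1..M. \<beta> * q i + T)"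
proof -
  interpret opportunistic_arq \<Omega> M lambda_p eps_s1 eps_s2 q pu tx err by fact
  show ?thesis
    using P_SU_eq_prod[of M] assms(7-9)
    by (simp add: outage_prob_def P_SU_def not_delivered_iff_reached)
qed

end
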